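(* Let $f:\mathbb{E}\to\mathbb{R}$ be differentiable and satisfy, for constants $\mu,L>0$ and all $x,y\in\mathbb{E}$, $\langle\nabla f(x)-\nabla f(y),x-y\rangle\ge\mu\|x-y\|^2$ and $\|\nabla f(x)-\nabla f(y)\|_*\le L\|x-y\|$. Let $f_*=\min f$ and $\kappa=L/\mu$. Let $\eta_1\in(0,\tfrac12]$ and let $(x_k)_{k\ge0}$ be generated by the BFGS method (see context) from $x_0\in\mathbb{E}$ and a positive definite $H_0:\mathbb{E}^*\to\mathbb{E}$, with step sizes chosen by backtracking from the unit step: $h_k=2^{-i_k}$, where $i_k\ge0$ is the smallest integer $i\ge0$ such that $$f(x_k)-f(x_k-2^{-i}d_k)\ge\eta_1\,2^{-i}\,\langle\nabla f(x_k),d_k\rangle.$$ Then, for all $k\ge1$, $$f(x_k)-f_*\le(1-\eta_1\kappa^{-2}\zeta_k)^k\,[f(x_0)-f_*],\qquad\zeta_k:=\exp(-\psi_0/k),$$ where $\psi_0:=\psi(LB,H_0^{-1})$.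
   Context: $\mathbb{E}$ is a real vector space of finite dimension $n\ge1$, $\mathbb{E}^*$ its dual, $\langle s,x\rangle$ the value of $s\in\mathbb{E}^*$ at $x\in\mathbb{E}$. $B:\mathbb{E}\to\mathbb{E}^*$ is a fixed self-adjoint positive definite operator; $\|u\|=\langle Bu,u\rangle^{1/2}$, $\|s\|_*=\langle s,B^{-1}s\rangle^{1/2}$. For self-adjoint positive definite $X,Y:\mathbb{E}\to\mathbb{E}^*$, $\psi(X,Y):=\operatorname{Tr}(X^{-1}(Y-X))-\ln\det(X^{-1}Y)\ (\ge0)$. BFGS method: given $x_0$ and self-adjoint positive definite $H_0:\mathbb{E}^*\to\mathbb{E}$, for $k\ge0$: $d_k=H_k\nabla f(x_k)$; choose a step size $h_k>0$; $x_{k+1}=x_k-h_kd_k$; $\delta_k=x_{k+1}-x_k$, $\gamma_k=\nabla f(x_{k+1})-\nabla f(x_k)$; $$H_{k+1}=H_k-\frac{H_k\gamma_k\delta_k^*+\delta_k\gamma_k^*H_k}{\langle\gamma_k,\delta_k\rangle}+\Bigl(\frac{\langle\gamma_k,H_k\gamma_k\rangle}{\langle\gamma_k,\delta_k\rangle}+1\Bigr)\frac{\delta_k\delta_k^*}{\langle\gamma_k,\delta_k\rangle},$$ where, e.g., $(\delta\delta^* )s=\langle s,\delta\rangle\delta$ and $(H\gamma\delta^* )s=\langle s,\delta\rangle H\gamma$. Equivalently, $G_k:=H_k^{-1}$ satisfies $G_{k+1}=G_k-\frac{G_k\delta_k\delta_k^*G_k}{\langle G_k\delta_k,\delta_k\rangle}+\frac{\gamma_k\gamma_k^*}{\langle\gamma_k,\delta_k\rangle}$.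 Standing assumption: $\langle\gamma_k,\delta_k\rangle>0$ for all $k\ge0$ (otherwise the method has already found the minimizer). All $H_k$ are then positive definite. *)

theory Defs
  imports "HOL-Analysis.Analysis"
begin

text \<open>
  The space is an arbitrary type \<open>'a\<close> of class \<open>euclidean_space\<close>, and its dual is
  \<open>'a \<Rightarrow>\<^sub>L real\<close> (in finite dimension every linear functional is bounded), so the pairing
  of \<open>s\<close> and \<open>x\<close> is \<open>blinfun_apply s x\<close>. The inner product of the class is used only to
  read off coordinates for traces and determinants, which do not depend on the basis.
\<close>

type_synonym 'a dual = "'a \<Rightarrow>\<^sub>L real"

definition spd :: "('a::euclidean_space \<Rightarrow> 'a dual) \<Rightarrow> bool" where
  "spd A \<longleftrightarrow> linear A \<and> (\<forall>u v. blinfun_apply (A u) v = blinfun_apply (A v) u) \<and>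
     (\<forall>u. u \<noteq> 0 \<longrightarrow> blinfun_apply (A u) u > 0)"

definition spd_dual :: "('a::euclidean_space dual \<Rightarrow> 'a) \<Rightarrow> bool" where
  "spd_dual H \<longleftrightarrow> linear H \<and> (\<forall>s t. blinfun_apply s (H t) = blinfun_apply t (H s)) \<and>
     (\<forall>s. s \<noteq> 0 \<longrightarrow> blinfun_apply s (H s) > 0)"

definition norm_wrt :: "('a::euclidean_space \<Rightarrow> 'a dual) \<Rightarrow> 'a \<Rightarrow> real" where
  "norm_wrt B u = sqrt (blinfun_apply (B u) u)"

definition dual_norm_wrt :: "('a::euclidean_space \<Rightarrow> 'a dual) \<Rightarrow> 'a dual \<Rightarrow> real" where
  "dual_norm_wrt B s = sqrt (blinfun_apply s (inv B s))"

text \<open>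
  The type \<open>'a basis_index\<close> has \<open>DIM('a)\<close> elements. It indexes the rows and columns of the
  matrix of an endomorphism of \<open>'a\<close>, so that the library's \<^const>\<open>trace\<close> and \<^const>\<open>det\<close> apply.
\<close>

typedef (overloaded) ('a::euclidean_space) basis_index = "Basis :: 'a set"
  by (rule ex_in_conv[THEN iffD2]) (rule nonempty_Basis)

instance basis_index :: (euclidean_space) finite
proof
  have "inj (Rep_basis_index :: 'a basis_index \<Rightarrow> 'a)"
    by (simp add: inj_def Rep_basis_index_inject)
  moreover have "finite (range (Rep_basis_index :: 'a basis_index \<Rightarrow> 'a))"
    by (rule finite_subset[OF _ finite_Basis]) (auto intro: Rep_basis_index)
  ultimately show "finite (UNIV :: 'a basis_index set)"
    by (rule finite_imageD[rotated])
qed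

definition endo_matrix ::
    "('a::euclidean_space \<Rightarrow> 'a) \<Rightarrow> real ^ 'a basis_index ^ 'a basis_index" where
  "endo_matrix A = (\<chi> i j. A (Rep_basis_index j) \<bullet> Rep_basis_index i)"

definition psi :: "('a::euclidean_space \<Rightarrow> 'a dual) \<Rightarrow> ('a \<Rightarrow> 'a dual) \<Rightarrow> real" where
  "psi X Y = trace (endo_matrix (\<lambda>u. inv X (Y u - X u))) - ln (det (endo_matrix (\<lambda>u. inv X (Y u))))"

definition bfgs_update ::
    "('a::euclidean_space dual \<Rightarrow> 'a) \<Rightarrow> 'a \<Rightarrow> 'a dual \<Rightarrow> 'a dual \<Rightarrow> 'a" where
  "bfgs_update H \<delta> \<gamma> = (\<lambda>s. H s
     - (1 / blinfun_apply \<gamma> \<delta>) *\<^sub>R (blinfun_apply s \<delta> *\<^sub>R H \<gamma> + blinfun_apply \<gamma> (H s) *\<^sub>R \<delta>)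
     + ((blinfun_apply \<gamma> (H \<gamma>) / blinfun_apply \<gamma> \<delta> + 1) * (1 / blinfun_apply \<gamma> \<delta>))
         *\<^sub>R (blinfun_apply s \<delta> *\<^sub>R \<delta>))"

definition bfgs_run ::
    "('a::euclidean_space \<Rightarrow> 'a dual) \<Rightarrow> (nat \<Rightarrow> real) \<Rightarrow> (nat \<Rightarrow> 'a)
      \<Rightarrow> (nat \<Rightarrow> 'a dual \<Rightarrow> 'a) \<Rightarrow> bool" where
  "bfgs_run g h x H \<longleftrightarrow> spd_dual (H 0) \<and>
     (\<forall>k. h k > 0 \<and>
          x (Suc k) = x k - h k *\<^sub>R H k (g (x k)) \<and>
          H (Suc k) = bfgs_update (H k) (x (Suc k) - x k) (g (x (Suc k)) - g (x k)))"

definition sufficient_decrease ::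
    "('a::euclidean_space \<Rightarrow> real) \<Rightarrow> ('a \<Rightarrow> 'a dual) \<Rightarrow> real \<Rightarrow> 'a \<Rightarrow> 'a \<Rightarrow> real \<Rightarrow> bool" where
  "sufficient_decrease f g \<eta> y d h \<longleftrightarrow> f y - f (y - h *\<^sub>R d) \<ge> \<eta> * h * blinfun_apply (g y) d"

end

theory Submission
  imports Defs
begin

text \<open>
  Put \<open>X = L B\<close> and \<open>G\<^sub>k = H\<^sub>k\<inverse>\<close>. The rank-two update changes \<open>\<psi>(X, G\<^sub>k)\<close> by an explicit amount, and
  co-coercivity of the gradient together with the backtracking rule bounds the growth by \<open>ln (2 \<kappa> h\<^sub>k q\<^sub>k)\<close>,
  where \<open>q\<^sub>k = L \<langle>\<nabla>f(x\<^sub>k), d\<^sub>k\<rangle> / \<parallel>\<nabla>f(x\<^sub>k)\<parallel>\<^sub>*\<^sup>2\<close>. Since \<open>\<psi> \<ge> 0\<close>, the product of the factors \<open>2 \<kappa> h\<^sub>j q\<^sub>j\<close>, \<open>j < k\<close>,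
  is at least \<open>exp (- \<psi>\<^sub>0)\<close>. Sufficient decrease and gradient dominance contract the gap \<open>f(x\<^sub>j) - f\<^sub>*\<close> by
  \<open>1 - r\<^sub>j\<close> with \<open>r\<^sub>j = \<eta>\<^sub>1 \<kappa>\<^sup>-\<^sup>2 (2 \<kappa> h\<^sub>j q\<^sub>j)\<close>, and two applications of AM-GM give the rate.
\<close>

section \<open>Traces and determinants of rank-one perturbations\<close>

text \<open>Adding multiples of row \<open>k\<close> to other rows keeps the determinant, so the
  rows in \<open>T\<close> can be filled in one by one, starting from the identity with row
  \<open>k\<close> replaced by \<open>b\<close>, where Cramer's rule applies.\<close>

lemma det_row_replaced_identity:
  fixes b :: "real ^ 'n"
  assumes "finite T" "k \<notin> T"
  shows "det (\<chi> i. if i = k then b else axis i 1 + (if i \<in> T then a i *s b else 0)) = b $ k"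
  using assms
proof (induction T rule: finite_induct)
  case empty
  have "b = (\<Sum>i\<in>UNIV. b $ i *s row i (mat 1))"
    by (simp add: vec_eq_iff row_def mat_def if_distrib cong: if_cong)
  moreover have "row i (mat 1 :: real ^ 'n ^ 'n) = axis i 1" for i
    by (simp add: row_def mat_def axis_def vec_eq_iff)
  ultimately show ?case
    using cramer_lemma_transpose[of k b "mat 1"] by (simp cong: if_cong)
next
  case (insert j T)
  let ?M = "\<chi> i. if i = k then b else axis i 1 + (if i \<in> T then a i *s b else 0)"
  have "(\<chi> r. if r = j then row j ?M + a j *s row k ?M else row r ?M)
      = (\<chi> i. if i = k then b else axis i 1 + (if i \<in> insert j T then a i *s b else 0))"
    using insert.hyps insert.prems by (auto simp: vec_eq_iff row_def)
  with det_row_operation[of j k ?M "a j"] insert show ?case by auto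
qed

text \<open>The matrix determinant lemma. Rows are switched on one at a time: multilinearity in row
  \<open>k\<close> splits off \<open>a k\<close> times a determinant whose row \<open>k\<close> is
  \<open>b\<close>, and the preceding lemma evaluates it.\<close>

lemma det_rank_one_update:
  fixes b :: "real ^ 'n"
  shows "det (\<chi> i. axis i 1 + a i *s b) = 1 + (\<Sum>i\<in>UNIV. a i * b $ i)"
proof -
  have "det (\<chi> i. axis i 1 + (if i \<in> T then a i *s b else 0)) = 1 + (\<Sum>i\<in>T. a i * b $ i)"
    if "finite T" for T
    using that
  proof (induction T rule: finite_induct)
    case empty
    have "(\<chi> i. axis i 1) = (mat 1 :: real ^ 'n ^ 'n)"
      by (simp add: vec_eq_iff mat_def axis_def)
    then show ?case by simp
  next
    case (insert k T)
    let ?c = "\<lambda>i. axis i 1 + (if i \<in> T then a i *s b else 0)"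
    have "(\<chi> i. axis i 1 + (if i \<in> insert k T then a i *s b else 0))
        = (\<chi> i. if i = k then axis i 1 + a k *s b else ?c i)"
      by (auto simp: vec_eq_iff)
    moreover have "(\<chi> i. if i = k then axis i 1 else ?c i) = (\<chi> i. ?c i)"
      using insert.hyps by (auto simp: vec_eq_iff)
    ultimately show ?case
      using insert det_row_add[of k "\<lambda>i. axis i 1" "\<lambda>i. a k *s b" ?c]
        det_row_mul[of k "a k" "\<lambda>i. b" ?c] det_row_replaced_identity[of T k b a]
      by simp
  qed
  from this[of UNIV] show ?thesis by simp
qed

section \<open>Matrices of endomorphisms in the standard basis\<close>

lemma sum_basis_index: "(\<Sum>k\<in>UNIV. F (Rep_basis_index k)) = sum F (Basis :: 'a::euclidean_space set)"
proof -
  have "bij_betw Rep_basis_index UNIV (Basis :: 'a set)"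
    using type_definition.Rep_range[OF type_definition_basis_index]
    by (simp add: bij_betw_def inj_def Rep_basis_index_inject)
  then show ?thesis by (rule sum.reindex_bij_betw)
qed

lemma endo_matrix_add: "endo_matrix (\<lambda>u. A u + C u) = endo_matrix A + endo_matrix C"
  by (simp add: endo_matrix_def vec_eq_iff inner_add_left)

lemma endo_matrix_diff: "endo_matrix (\<lambda>u. A u - C u) = endo_matrix A - endo_matrix C"
  by (simp add: endo_matrix_def vec_eq_iff inner_diff_left)

lemma endo_matrix_0: "endo_matrix (\<lambda>u. 0) = mat 0"
  by (simp add: endo_matrix_def vec_eq_iff mat_def)

lemma endo_matrix_id: "endo_matrix (\<lambda>u. u) = mat 1"
  by (simp add: endo_matrix_def vec_eq_iff mat_def inner_Basis Rep_basis_index Rep_basis_index_inject)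

lemma endo_matrix_compose:
  assumes "linear A"
  shows "endo_matrix (\<lambda>u. A (C u)) = endo_matrix A ** endo_matrix C"
proof -
  interpret linear A by fact
  have expand: "A y \<bullet> z = (\<Sum>k\<in>UNIV. A (Rep_basis_index k) \<bullet> z * (y \<bullet> Rep_basis_index k))" for y z :: 'a
  proof -
    have "A y \<bullet> z = A (\<Sum>b\<in>Basis. (y \<bullet> b) *\<^sub>R b) \<bullet> z" by (simp add: euclidean_representation)
    also have "\<dots> = (\<Sum>b\<in>Basis. A b \<bullet> z * (y \<bullet> b))"
      by (simp add: sum scale inner_sum_left mult.commute[of "_ \<bullet> z"])
    finally show ?thesis by (simp only: sum_basis_index[of "\<lambda>b. A b \<bullet> z * (y \<bullet> b)"])
  qed
  then show ?thesis 
    unfolding endo_matrix_def matrix_matrix_mult_def vec_eq_iff vec_lambda_beta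
    by (intro allI expand)
qed

lemma trace_rank_one:
  fixes \<phi> :: "'a::euclidean_space dual"
  shows "trace (endo_matrix (\<lambda>v. \<phi> v *\<^sub>R u)) = \<phi> u"
proof -
  have "trace (endo_matrix (\<lambda>v. \<phi> v *\<^sub>R u)) = (\<Sum>b\<in>Basis. \<phi> b * (u \<bullet> b))"
    by (simp add: trace_def endo_matrix_def sum_basis_index[of "\<lambda>b. \<phi> b * (u \<bullet> b)"])
  also have "\<dots> = \<phi> u"
    by (subst (2) euclidean_representation[of u, symmetric])
      (simp only: blinfun.sum_right blinfun.scaleR_right real_scaleR_def mult.commute)
  finally show ?thesis .
qed

lemma det_endo_rank_one_update:
  fixes \<phi> :: "'a::euclidean_space dual"
  shows "det (endo_matrix (\<lambda>v. v + \<phi> v *\<^sub>R u)) = 1 + \<phi> u"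
proof -
  have "endo_matrix (\<lambda>v. v + \<phi> v *\<^sub>R u)
      = (\<chi> i. axis i 1 + (u \<bullet> Rep_basis_index i) *s (\<chi> j. \<phi> (Rep_basis_index j)))"
    by (auto simp: endo_matrix_def vec_eq_iff axis_def inner_add_left inner_Basis
        Rep_basis_index Rep_basis_index_inject)
  then have "det (endo_matrix (\<lambda>v. v + \<phi> v *\<^sub>R u))
      = 1 + (\<Sum>i\<in>UNIV. (u \<bullet> Rep_basis_index i) * \<phi> (Rep_basis_index i))"
    by (simp only: det_rank_one_update) simp
  also have "\<dots> = 1 + trace (endo_matrix (\<lambda>v. \<phi> v *\<^sub>R u))"
    by (simp add: trace_def endo_matrix_def mult.commute)
  finally show ?thesis by (simp add: trace_rank_one)
qed

section \<open>The BFGS update and its potential\<close>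

lemma spd_linear: "spd A \<Longrightarrow> linear A"
  and spd_sym: "spd A \<Longrightarrow> A u v = A v u"
  and spd_pos: "spd A \<Longrightarrow> u \<noteq> 0 \<Longrightarrow> A u u > 0"
  by (auto simp: spd_def)

lemma spd_nonneg: "spd A \<Longrightarrow> A u u \<ge> 0"
  using spd_pos[of A u] linear_0[OF spd_linear, of A] by (cases "u = 0") auto

lemma spd_eq_0D: "spd A \<Longrightarrow> A u u = 0 \<Longrightarrow> u = 0"
  using spd_pos[of A u] by fastforce

lemmas spd_linear_simps = linear_add[OF spd_linear] linear_diff[OF spd_linear] linear_0[OF spd_linear]
  linear_cmul[OF spd_linear]

text \<open>Riesz representation in coordinates. It identifies the dual with the space, so that
  dimension arguments for endomorphisms reach maps into or out of the dual.\<close>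

lemma blinfun_inner_left_representation:
  fixes s :: "'a::euclidean_space dual"
  shows "blinfun_inner_left (\<Sum>b\<in>Basis. s b *\<^sub>R b) = s"
  by (rule blinfun_euclidean_eqI) (metis blinfun_inner_left.rep_eq inner_commute inner_sum_left_Basis)

lemma bij_blinfun_inner_left: "bij (blinfun_inner_left :: 'a::euclidean_space \<Rightarrow> 'a dual)"
proof (rule bijI)
  show "inj (blinfun_inner_left :: 'a \<Rightarrow> 'a dual)"
    by (metis (no_types) blinfun_inner_left.rep_eq injI inner_commute vector_eq_rdot)
  show "surj (blinfun_inner_left :: 'a \<Rightarrow> 'a dual)"
    by (rule surjI) (rule blinfun_inner_left_representation)
qed

lemma linear_blinfun_inner_left: "linear (blinfun_inner_left :: 'a::euclidean_space \<Rightarrow> 'a dual)"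
  by (simp add: bounded_linear_blinfun_inner_left bounded_linear.linear)

text \<open>Positivity gives injectivity. Up to the Riesz identification \<open>A\<close> is the
  endomorphism \<open>T\<close>, and an injective endomorphism of a finite-dimensional space is
  surjective.\<close>

lemma spd_bij:
  fixes A :: "'a::euclidean_space \<Rightarrow> 'a dual"
  assumes A: "spd A"
  shows "bij A"
proof -
  define T where "T u = (\<Sum>b\<in>Basis. A u b *\<^sub>R b)" for u
  have AT: "A u = blinfun_inner_left (T u)" for u
    by (simp add: T_def blinfun_inner_left_representation)
  have inj: "inj A"
    using spd_eq_0D[OF A] by (auto simp: linear_injective_0[OF spd_linear[OF A]])
  moreover have "linear T"
    by (rule linearI)
      (simp_all add: T_def spd_linear_simps[OF A] plus_blinfun.rep_eq scaleR_blinfun.rep_eq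
        scaleR_left_distrib sum.distrib scaleR_sum_right)
  moreover have "inj T"
    using inj AT by (metis injI injD)
  ultimately have "surj T" by (simp add: linear_injective_imp_surjective)
  then have "surj A"
    using AT bij_blinfun_inner_left by (metis (no_types, lifting) bij_is_surj surj_def)
  with inj show ?thesis by (simp add: bij_def)
qed

lemma spd_inv: "spd A \<Longrightarrow> A (inv A s) = s" "spd A \<Longrightarrow> inv A (A u) = u"
  using spd_bij[of A] by (simp_all add: bij_is_surj bij_is_inj surj_f_inv_f)

lemma spd_inv_eqI: "spd A \<Longrightarrow> A u = s \<Longrightarrow> inv A s = u"
  using spd_inv by blast

lemma linear_inv_spd:
  assumes A: "spd A"
  shows "linear (inv A)"
  by (rule linearI; rule spd_inv_eqI[OF A]) (simp_all add: spd_linear_simps[OF A] spd_inv[OF A])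

text \<open>Links the method, run on \<open>H\<close>, to the potential, taken at
  \<open>inv H\<close>. Composing \<open>H\<close> with the Riesz identification again reduces
  surjectivity to an endomorphism.\<close>

lemma spd_dual_inverse:
  fixes H :: "'a::euclidean_space dual \<Rightarrow> 'a"
  assumes H: "spd_dual H"
  shows "spd (inv H)" "inv (inv H) = H"
proof -
  let ?R = "blinfun_inner_left :: 'a \<Rightarrow> 'a dual"
  have lin: "linear H" and sym: "\<And>s t. blinfun_apply s (H t) = blinfun_apply t (H s)"
    and pos: "\<And>s. s \<noteq> 0 \<Longrightarrow> blinfun_apply s (H s) > 0"
    using H by (auto simp: spd_dual_def)
  have inj: "inj H"
    using pos by (auto simp: linear_injective_0[OF lin]) (metis blinfun.zero_right less_irrefl)
  have "linear (H \<circ> ?R)" by (intro linear_compose lin linear_blinfun_inner_left)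
  moreover have "inj (H \<circ> ?R)"
    by (intro inj_compose inj bij_is_inj bij_blinfun_inner_left)
  ultimately have "surj (H \<circ> ?R)" using linear_injective_imp_surjective[of "H \<circ> ?R"] by blast
  then have surj: "surj H" by (fastforce simp: surj_def)
  show "inv (inv H) = H" using inj surj by (simp add: bijI inv_inv_eq)
  have H_inv: "H (inv H u) = u" for u using surj by (simp add: surj_f_inv_f)
  have eqI: "inv H u = s" if "H s = u" for u s using that inj by (simp add: inv_f_eq)
  have "linear (inv H)"
    by (rule linearI; rule eqI) (simp_all add: linear_add[OF lin] linear_cmul[OF lin] H_inv)
  moreover have "inv H u v = inv H v u" for u v
    using sym[of "inv H u" "inv H v"] by (simp add: H_inv)
  moreover have "inv H u u > 0" if "u \<noteq> 0" for u
    using pos[of "inv H u"] that linear_0[OF lin] H_inv[of u] by (metis)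
  ultimately show "spd (inv H)" by (simp add: spd_def)
qed

lemma spd_Cauchy_Schwarz:
  fixes A :: "'a::euclidean_space \<Rightarrow> 'a dual"
  assumes A: "spd A"
  shows "(A u v)\<^sup>2 \<le> A u u * A v v"
proof (cases "v = 0")
  case True
  then show ?thesis by simp
next
  case False
  then have pos: "A v v > 0" by (rule spd_pos[OF A])
  \<comment> \<open>This coefficient makes the residual \<open>u - ?c v\<close> orthogonal to
    \<open>v\<close> with respect to \<open>A\<close>.\<close>
  let ?c = "A u v / A v v"
  have "0 \<le> A (u - ?c *\<^sub>R v) (u - ?c *\<^sub>R v)" by (rule spd_nonneg[OF A])
  also have "\<dots> = A u u - 2 * ?c * A u v + ?c * ?c * A v v"
    by (simp add: spd_linear_simps[OF A] blinfun.diff_left blinfun.diff_right blinfun.scaleR_left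
        blinfun.scaleR_right spd_sym[OF A, of v u] algebra_simps)
  also have "\<dots> = A u u - (A u v)\<^sup>2 / A v v"
    using pos by (simp add: field_simps power2_eq_square)
  finally show ?thesis using pos by (simp add: field_simps)
qed

lemma spd_dual_Cauchy_Schwarz:
  fixes s :: "'a::euclidean_space dual"
  assumes A: "spd A"
  shows "(s u)\<^sup>2 \<le> s (inv A s) * A u u"
  using spd_Cauchy_Schwarz[OF A, of "inv A s" u] by (simp add: spd_inv[OF A])

lemma spd_inv_nonneg: "spd A \<Longrightarrow> (s :: 'a::euclidean_space dual) (inv A s) \<ge> 0"
  using spd_nonneg[of A "inv A s"] by (simp add: spd_inv)

lemma spd_inv_pos: "spd A \<Longrightarrow> (s :: 'a::euclidean_space dual) \<noteq> 0 \<Longrightarrow> s (inv A s) > 0"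
  using spd_pos[of A "inv A s"] by (metis blinfun.zero_right spd_inv(1) spd_linear_simps(3))

section \<open>The BFGS update written for the inverse operator\<close>

definition inverse_update ::
    "('a::euclidean_space \<Rightarrow> 'a dual) \<Rightarrow> 'a \<Rightarrow> 'a dual \<Rightarrow> 'a \<Rightarrow> 'a dual" where
  "inverse_update G \<delta> \<gamma> = (\<lambda>u. G u - (G \<delta> u / G \<delta> \<delta>) *\<^sub>R G \<delta> + (\<gamma> u / \<gamma> \<delta>) *\<^sub>R \<gamma>)"

text \<open>The first two terms give the value of \<open>G\<close> at the
  \<open>G\<close>-orthogonal residual of \<open>u\<close> modulo \<open>\<delta>\<close>. It
  vanishes only on multiples of \<open>\<delta>\<close>, and at the nonzero ones the
  \<open>\<gamma>\<close> term is positive.\<close>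

lemma spd_inverse_update:
  fixes G :: "'a::euclidean_space \<Rightarrow> 'a dual" and \<gamma> :: "'a dual"
  assumes G: "spd G" and curv: "\<gamma> \<delta> > 0"
  shows "spd (inverse_update G \<delta> \<gamma>)"
proof -
  let ?G' = "inverse_update G \<delta> \<gamma>"
  from curv have "\<delta> \<noteq> 0" by auto
  then have pos: "G \<delta> \<delta> > 0" by (rule spd_pos[OF G])
  have lin: "linear ?G'"
    by (rule linearI) (simp_all add: inverse_update_def spd_linear_simps[OF G] blinfun.add_right
        blinfun.scaleR_right add_divide_distrib algebra_simps)
  have G': "?G' u v = G u v - G \<delta> u * G \<delta> v / G \<delta> \<delta> + \<gamma> u * \<gamma> v / \<gamma> \<delta>" for u v
    by (simp add: inverse_update_def blinfun.add_left blinfun.diff_left blinfun.scaleR_left)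
  have "?G' u u > 0" if "u \<noteq> 0" for u
  proof -
    let ?c = "G \<delta> u / G \<delta> \<delta>"
    have *: "?G' u u = G (u - ?c *\<^sub>R \<delta>) (u - ?c *\<^sub>R \<delta>) + (\<gamma> u)\<^sup>2 / \<gamma> \<delta>"
      using pos by (simp add: G' spd_linear_simps[OF G] blinfun.diff_left blinfun.diff_right
          blinfun.scaleR_left blinfun.scaleR_right spd_sym[OF G, of u \<delta>] field_simps power2_eq_square)
    show ?thesis
    proof (cases "u = ?c *\<^sub>R \<delta>")
      case True
      then have "?c \<noteq> 0" "\<gamma> u = ?c * \<gamma> \<delta>"
        using that by (metis scaleR_zero_left, metis blinfun.scaleR_right real_scaleR_def)
      with curv have "(\<gamma> u)\<^sup>2 / \<gamma> \<delta> > 0" by simp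
      then show ?thesis using * spd_nonneg[OF G, of "u - ?c *\<^sub>R \<delta>"] by linarith
    next
      case False
      then have "G (u - ?c *\<^sub>R \<delta>) (u - ?c *\<^sub>R \<delta>) > 0" by (intro spd_pos[OF G]) simp
      moreover have "(\<gamma> u)\<^sup>2 / \<gamma> \<delta> \<ge> 0" using curv by simp
      ultimately show ?thesis using * by linarith
    qed
  qed
  with lin show ?thesis by (auto simp: spd_def G' spd_sym[OF G] mult.commute)
qed

text \<open>Every \<open>s\<close> has the form \<open>?G' u\<close>, so the formula need only be
  evaluated there. The value \<open>s \<delta> = \<gamma> u\<close> reflects the secant equation
  \<open>?G' \<delta> = \<gamma>\<close>, and everything except \<open>u\<close> cancels.\<close>

lemma bfgs_update_eq_inv:
  fixes G :: "'a::euclidean_space \<Rightarrow> 'a dual" and \<gamma> :: "'a dual"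
  assumes G: "spd G" and curv: "\<gamma> \<delta> > 0"
  shows "bfgs_update (inv G) \<delta> \<gamma> = inv (inverse_update G \<delta> \<gamma>)"
proof
  fix s
  let ?G' = "inverse_update G \<delta> \<gamma>"
  note G' = spd_inverse_update[of G \<gamma> \<delta>, OF G curv]
  interpret H: linear "inv G" by (rule linear_inv_spd[OF G])
  from curv have "\<delta> \<noteq> 0" by auto
  then have pos: "G \<delta> \<delta> > 0" by (rule spd_pos[OF G])
  obtain u where s: "s = ?G' u" by (metis spd_inv(1)[OF G'])
  let ?w = "inv G \<gamma>" and ?a = "G \<delta> u / G \<delta> \<delta>" and ?b = "\<gamma> u / \<gamma> \<delta>"
  have s': "s = G u - ?a *\<^sub>R G \<delta> + ?b *\<^sub>R \<gamma>" by (simp add: s inverse_update_def)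
  then have Hs: "inv G s = u - ?a *\<^sub>R \<delta> + ?b *\<^sub>R ?w"
    by (simp only: H.add H.diff H.scale spd_inv[OF G])
  have s\<delta>: "s \<delta> = \<gamma> u"
    using pos curv by (simp add: s' blinfun.add_left blinfun.diff_left blinfun.scaleR_left spd_sym[OF G, of u \<delta>])
  have "bfgs_update (inv G) \<delta> \<gamma> s = u + (- ?a - (1 / \<gamma> \<delta>) * (\<gamma> u - ?a * \<gamma> \<delta> + ?b * \<gamma> ?w)
      + (\<gamma> ?w / \<gamma> \<delta> + 1) * (1 / \<gamma> \<delta>) * \<gamma> u) *\<^sub>R \<delta>"
    unfolding bfgs_update_def s\<delta> Hs
    by (simp add: blinfun.add_right blinfun.diff_right blinfun.scaleR_right algebra_simps)
  also have "\<dots> = u" using curv pos by (simp add: field_simps)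
  finally show "bfgs_update (inv G) \<delta> \<gamma> s = inv ?G' s" by (simp add: s spd_inv[OF G'])
qed

text \<open>
  The update is \<open>G\<close> precomposed with a product of two rank-one perturbations of the identity,
  the first of which is unipotent.
\<close>
lemma det_inverse_update:
  fixes G :: "'a::euclidean_space \<Rightarrow> 'a dual" and \<gamma> :: "'a dual"
  assumes X: "spd X" and G: "spd G" and curv: "\<gamma> \<delta> > 0"
  shows "det (endo_matrix (\<lambda>u. inv X (inverse_update G \<delta> \<gamma> u)))
    = det (endo_matrix (\<lambda>u. inv X (G u))) * (\<gamma> \<delta> / G \<delta> \<delta>)"
proof -
  from curv have "\<delta> \<noteq> 0" by auto
  then have pos: "G \<delta> \<delta> > 0" by (rule spd_pos[OF G])
  define \<alpha> where "\<alpha> = (1 / G \<delta> \<delta>) *\<^sub>R G \<delta>"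
  define \<beta> where "\<beta> = (1 / \<gamma> \<delta>) *\<^sub>R \<gamma>"
  define w where "w = inv G \<gamma>"
  \<comment> \<open>Matching \<open>S (T u)\<close> with the update requires
    \<open>S z = w - \<delta>\<close>. Since \<open>\<beta> - \<alpha>\<close> vanishes at
    \<open>\<delta>\<close>, \<open>S\<close> is inverted by flipping the sign of its rank-one part,
    which yields this \<open>z\<close>.\<close>
  define z where "z = w - (1 - \<alpha> w + \<beta> w) *\<^sub>R \<delta>"
  define S where "S = (\<lambda>v. v + (\<beta> - \<alpha>) v *\<^sub>R \<delta>)"
  define T where "T = (\<lambda>v. v + \<beta> v *\<^sub>R z)"
  have \<alpha>\<beta>: "\<alpha> \<delta> = 1" "\<beta> \<delta> = 1"
    using pos curv by (simp_all add: \<alpha>_def \<beta>_def blinfun.scaleR_left)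
  have z: "\<beta> z = \<alpha> w - 1" "\<alpha> z = 2 * \<alpha> w - \<beta> w - 1"
    using \<alpha>\<beta> by (simp_all add: z_def blinfun.diff_right blinfun.scaleR_right)
  have ST: "S (T u) = u - \<alpha> u *\<^sub>R \<delta> + \<beta> u *\<^sub>R w" for u
  proof -
    have "(\<beta> - \<alpha>) (T u) = \<beta> u - \<alpha> u + \<beta> u * (\<beta> w - \<alpha> w)"
      by (simp add: T_def z blinfun.add_right blinfun.diff_left blinfun.scaleR_right algebra_simps)
    then have "S (T u) = T u + (\<beta> u - \<alpha> u + \<beta> u * (\<beta> w - \<alpha> w)) *\<^sub>R \<delta>"
      by (simp add: S_def)
    then show ?thesis by (simp add: T_def z_def algebra_simps)
  qed
  have "inverse_update G \<delta> \<gamma> u = G (S (T u))" for u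
    unfolding ST inverse_update_def
    by (simp add: spd_linear_simps[OF G] w_def spd_inv[OF G] \<alpha>_def \<beta>_def blinfun.scaleR_left)
  then have G': "inverse_update G \<delta> \<gamma> = (\<lambda>u. G (S (T u)))" by (rule ext)
  have linG: "linear (\<lambda>u. inv X (G u))"
    using linear_compose[OF spd_linear[OF G] linear_inv_spd[OF X]] by (simp add: o_def)
  have linS: "linear S"
    by (rule linearI) (simp_all add: S_def blinfun.add_right blinfun.scaleR_right algebra_simps)
  have "endo_matrix (\<lambda>u. inv X (inverse_update G \<delta> \<gamma> u))
      = endo_matrix (\<lambda>u. inv X (G u)) ** (endo_matrix S ** endo_matrix T)"
    unfolding G' endo_matrix_compose[OF linS, symmetric] by (rule endo_matrix_compose[OF linG])
  moreover have "det (endo_matrix S) = 1"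
    unfolding S_def det_endo_rank_one_update by (simp add: blinfun.diff_left \<alpha>\<beta>)
  moreover have "det (endo_matrix T) = \<gamma> \<delta> / G \<delta> \<delta>"
    unfolding T_def det_endo_rank_one_update
    by (simp add: z) (simp add: \<alpha>_def w_def blinfun.scaleR_left spd_sym[OF G, of \<delta> "inv G \<gamma>"] spd_inv[OF G])
  ultimately show ?thesis by (simp add: det_mul)
qed

lemma trace_inverse_update:
  fixes G :: "'a::euclidean_space \<Rightarrow> 'a dual" and \<gamma> :: "'a dual"
  assumes X: "spd X"
  shows "trace (endo_matrix (\<lambda>u. inv X (inverse_update G \<delta> \<gamma> u - X u)))
    = trace (endo_matrix (\<lambda>u. inv X (G u - X u))) - G \<delta> (inv X (G \<delta>)) / G \<delta> \<delta>
      + \<gamma> (inv X \<gamma>) / \<gamma> \<delta>"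
proof -
  interpret I: linear "inv X" by (rule linear_inv_spd[OF X])
  have "inv X (inverse_update G \<delta> \<gamma> u - X u) = inv X (G u - X u)
      - G \<delta> u *\<^sub>R ((1 / G \<delta> \<delta>) *\<^sub>R inv X (G \<delta>)) + \<gamma> u *\<^sub>R ((1 / \<gamma> \<delta>) *\<^sub>R inv X \<gamma>)" for u
    by (simp add: inverse_update_def I.add I.diff I.scale)
  then show ?thesis
    by (simp only: endo_matrix_add endo_matrix_diff trace_add trace_sub trace_rank_one)
      (simp add: blinfun.scaleR_right)
qed

text \<open>The hypothesis \<open>det\<close> lets the logarithm of the product split. It is
  established for all positive definite \<open>G\<close> only by the induction below, which itself
  uses this formula.\<close>

lemma psi_inverse_update:
  fixes G :: "'a::euclidean_space \<Rightarrow> 'a dual" and \<gamma> :: "'a dual"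
  assumes X: "spd X" and G: "spd G" and curv: "\<gamma> \<delta> > 0"
    and det: "det (endo_matrix (\<lambda>u. inv X (G u))) > 0"
  shows "psi X (inverse_update G \<delta> \<gamma>)
    = psi X G - G \<delta> (inv X (G \<delta>)) / G \<delta> \<delta> + \<gamma> (inv X \<gamma>) / \<gamma> \<delta> - ln (\<gamma> \<delta> / G \<delta> \<delta>)"
proof -
  from curv have "\<delta> \<noteq> 0" by auto
  then have "G \<delta> \<delta> > 0" by (rule spd_pos[OF G])
  with curv have "\<gamma> \<delta> / G \<delta> \<delta> > 0" by simp
  then show ?thesis
    unfolding psi_def trace_inverse_update[OF X] det_inverse_update[of X G \<gamma> \<delta>, OF X G curv]
    using det ln_mult_pos[OF det, of "\<gamma> \<delta> / G \<delta> \<delta>"] by simp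
qed

lemma psi_self: "spd X \<Longrightarrow> det (endo_matrix (\<lambda>u. inv X (X u))) = 1" "spd X \<Longrightarrow> psi X X = 0"
  using linear_0[OF linear_inv_spd, of X]
  by (simp_all add: psi_def spd_inv endo_matrix_id endo_matrix_0[unfolded mat_0] trace_0[unfolded mat_0])

text \<open>
  Quadratic termination of BFGS: updating \<open>Y\<close> with \<open>\<gamma> = X \<delta>\<close>, where \<open>\<delta>\<close> is \<open>X\<close>-orthogonal to the subspace
  on which \<open>Y\<close> already agrees with \<open>X\<close>, enlarges this subspace and does not increase \<open>psi X\<close>.
\<close>
lemma det_pos_psi_nonneg:
  fixes X Y :: "'a::euclidean_space \<Rightarrow> 'a dual"
  assumes X: "spd X" and "spd Y"
  shows "det (endo_matrix (\<lambda>u. inv X (Y u))) > 0 \<and> psi X Y \<ge> 0"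
  using \<open>spd Y\<close>
\<comment> \<open>Induction on the codimension of the agreement subspace. At codimension zero
  \<open>Y = X\<close>, where \<open>psi\<close> vanishes; otherwise \<open>psi X Y\<close> is
  bounded below by its value after an update.\<close>
proof (induction "DIM('a) - dim {u. Y u = X u}" arbitrary: Y rule: less_induct)
  case less
  note Y = less.prems
  let ?S = "{u. Y u = X u}"
  have subspace: "subspace {u. Z u = X u}" if "spd Z" for Z
    using X that by (auto simp: subspace_def spd_linear_simps)
  show ?case
  proof (cases "dim ?S < DIM('a)")
    case False
    then have "?S = UNIV"
      using dim_eq_full[of ?S] dim_subset_UNIV[of ?S] subspace[OF Y]
      by (metis antisym_conv2 span_eq_iff)
    then have "Y = X" by auto
    with psi_self[OF X] show ?thesis by simp
  next
    case True
    then obtain n where n: "n \<noteq> 0" "\<And>y. y \<in> span ?S \<Longrightarrow> orthogonal n y"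
      by (rule orthogonal_to_subspace_exists) blast
    \<comment> \<open>\<open>X\<close> maps \<open>\<delta>\<close> to the functional of the
      Euclidean normal \<open>n\<close>, so Euclidean orthogonality to \<open>?S\<close> becomes
      \<open>X\<close>-orthogonality.\<close>
    define \<delta> where "\<delta> = inv X (blinfun_inner_left n)"
    have X\<delta>: "X \<delta> v = v \<bullet> n" for v by (simp add: \<delta>_def spd_inv[OF X])
    have \<delta>: "\<delta> \<noteq> 0" using X\<delta>[of n] n(1) by (auto simp: spd_linear_simps[OF X])
    then have pX: "X \<delta> \<delta> > 0" and pY: "Y \<delta> \<delta> > 0" using spd_pos X Y by auto
    have orth: "X \<delta> v = 0" if "v \<in> ?S" for v
      using n(2)[OF span_base[OF that]] by (simp add: X\<delta> orthogonal_def inner_commute)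
    let ?Y' = "inverse_update Y \<delta> (X \<delta>)"
    have Y': "spd ?Y'" by (rule spd_inverse_update[OF Y pX])
    \<comment> \<open>On \<open>?S\<close> symmetry gives
      \<open>Y \<delta> v = X \<delta> v = 0\<close>, so both rank-one corrections vanish
      there.\<close>
    have "?Y' v = X v" if "v \<in> ?S" for v
      using orth[OF that] that spd_sym[OF Y, of \<delta> v] spd_sym[OF X, of \<delta> v]
      by (simp add: inverse_update_def)
    then have sub: "?S \<subseteq> {u. ?Y' u = X u}" by blast
    moreover have "?Y' \<delta> = X \<delta>" using pX pY by (simp add: inverse_update_def)
    moreover have "\<delta> \<notin> ?S" using orth[of \<delta>] pX by auto
    ultimately have "?S \<subset> {u. ?Y' u = X u}" by blast
    then have "dim ?S < dim {u. ?Y' u = X u}"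
      using dim_psubset[of ?S "{u. ?Y' u = X u}"] subspace[OF Y] subspace[OF Y']
      by (simp add: span_eq_iff[THEN iffD2])
    with True have IH: "det (endo_matrix (\<lambda>u. inv X (?Y' u))) > 0" "psi X ?Y' \<ge> 0"
      using less.hyps[of ?Y'] Y' by auto
    have ratio: "X \<delta> \<delta> / Y \<delta> \<delta> > 0" using pX pY by simp
    have det: "det (endo_matrix (\<lambda>u. inv X (Y u))) > 0"
      using IH(1) ratio unfolding det_inverse_update[of X Y "X \<delta>" \<delta>, OF X Y pX]
      by (rule zero_less_mult_pos2)
    \<comment> \<open>With \<open>t = Y \<delta> \<delta> / X \<delta> \<delta>\<close>,
      Cauchy-Schwarz bounds the change of \<open>psi\<close> by \<open>1 - t + ln t\<close>, which
      is at most 0.\<close>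
    have "ln (Y \<delta> \<delta> / X \<delta> \<delta>) \<le> Y \<delta> \<delta> / X \<delta> \<delta> - 1"
      using pX pY by (intro ln_le_minus_one) simp
    also have "Y \<delta> \<delta> / X \<delta> \<delta> \<le> Y \<delta> (inv X (Y \<delta>)) / Y \<delta> \<delta>"
      using spd_dual_Cauchy_Schwarz[OF X, of "Y \<delta>" \<delta>] pX pY by (simp add: field_simps power2_eq_square)
    finally have "psi X ?Y' \<le> psi X Y"
      using psi_inverse_update[of X Y "X \<delta>" \<delta>, OF X Y pX det] pX pY
      by (simp add: spd_inv[OF X] ln_div)
    with IH det show ?thesis by simp
  qed
qed

section \<open>Smooth strongly convex functions\<close>

text \<open>Squared norms are written as values of the quadratic forms of \<open>B\<close> and
  \<open>inv B\<close>, which keeps square roots out of the estimates.\<close>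

locale smooth_strongly_convex =
  fixes B :: "'a::euclidean_space \<Rightarrow> 'a dual"
    and f :: "'a \<Rightarrow> real"
    and grad :: "'a \<Rightarrow> 'a dual"
    and \<mu> L :: real
  assumes B: "spd B"
    and differentiable: "\<And>y. (f has_derivative blinfun_apply (grad y)) (at y)"
    and pos: "\<mu> > 0" "L > 0"
    and strongly_monotone: "\<And>y z. (grad y - grad z) (y - z) \<ge> \<mu> * B (y - z) (y - z)"
    and Lipschitz_gradient:
      "\<And>y z. (grad y - grad z) (inv B (grad y - grad z)) \<le> L\<^sup>2 * B (y - z) (y - z)"
begin

lemma B_scale: "B (c *\<^sub>R v) (c *\<^sub>R v) = c\<^sup>2 * B v v"
  by (simp add: spd_linear_simps[OF B] blinfun.scaleR_left blinfun.scaleR_right power2_eq_square)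

lemma has_derivative_line:
  "((\<lambda>t. f (y + t *\<^sub>R d)) has_real_derivative grad (y + t *\<^sub>R d) d) (at t)"
proof -
  have "((\<lambda>t. y + t *\<^sub>R d) has_derivative (\<lambda>t. t *\<^sub>R d)) (at t)"
    by (auto intro!: derivative_eq_intros)
  from has_derivative_compose[OF this differentiable] show ?thesis
    by (simp add: has_field_derivative_def blinfun.scaleR_right mult.commute[of _ "grad _ _"])
qed

text \<open>Along the segment, \<open>f\<close> minus its quadratic upper model is nonincreasing:
  dual Cauchy-Schwarz and the Lipschitz bound control the change of the directional
  derivative.\<close>

lemma descent: "f z \<le> f y + grad y (z - y) + L / 2 * B (z - y) (z - y)"
proof -
  define d where "d = z - y"
  define \<phi> where "\<phi> t = f (y + t *\<^sub>R d) - t * grad y d - L / 2 * t\<^sup>2 * B d d" for t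
  have "\<phi> 1 \<le> \<phi> 0"
  proof (rule DERIV_nonpos_imp_nonincreasing[where f = \<phi>])
    fix t :: real
    assume "0 \<le> t"
    let ?\<gamma> = "grad (y + t *\<^sub>R d) - grad y"
    have "(\<phi> has_real_derivative (grad (y + t *\<^sub>R d) d - grad y d - L * t * B d d)) (at t)"
      unfolding \<phi>_def by (auto intro!: derivative_eq_intros has_derivative_line)
    moreover have "?\<gamma> d \<le> L * t * B d d"
    proof (rule power2_le_imp_le)
      have "(?\<gamma> d)\<^sup>2 \<le> ?\<gamma> (inv B ?\<gamma>) * B d d" by (rule spd_dual_Cauchy_Schwarz[OF B])
      also have "\<dots> \<le> (L\<^sup>2 * B (t *\<^sub>R d) (t *\<^sub>R d)) * B d d"
        using Lipschitz_gradient[of "y + t *\<^sub>R d" y] spd_nonneg[OF B] by (intro mult_right_mono) auto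
      also have "\<dots> = (L * t * B d d)\<^sup>2" by (simp only: B_scale) (simp add: power2_eq_square)
      finally show "(?\<gamma> d)\<^sup>2 \<le> (L * t * B d d)\<^sup>2" .
      show "0 \<le> L * t * B d d" using pos \<open>0 \<le> t\<close> spd_nonneg[OF B] by simp
    qed
    ultimately show "\<exists>D. (\<phi> has_real_derivative D) (at t) \<and> D \<le> 0"
      by (auto simp: blinfun.diff_left)
  qed simp
  then show ?thesis by (simp add: \<phi>_def d_def)
qed

lemma descent_along: "f (y - c *\<^sub>R v) \<le> f y - c * grad y v + L / 2 * (c\<^sup>2 * B v v)"
proof -
  have "y - c *\<^sub>R v - y = (- c) *\<^sub>R v" by simp
  from descent[of "y - c *\<^sub>R v" y, unfolded this B_scale] show ?thesis
    by (simp add: blinfun.minus_right blinfun.scaleR_right)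
qed

lemma strong_convexity: "f z \<ge> f y + grad y (z - y) + \<mu> / 2 * B (z - y) (z - y)"
proof -
  define d where "d = z - y"
  define \<phi> where "\<phi> t = f (y + t *\<^sub>R d) - t * grad y d - \<mu> / 2 * t\<^sup>2 * B d d" for t
  have "\<phi> 0 \<le> \<phi> 1"
  proof (rule DERIV_nonneg_imp_nondecreasing[where f = \<phi>])
    fix t :: real
    assume "0 \<le> t"
    let ?\<gamma> = "grad (y + t *\<^sub>R d) - grad y"
    have "(\<phi> has_real_derivative (grad (y + t *\<^sub>R d) d - grad y d - \<mu> * t * B d d)) (at t)"
      unfolding \<phi>_def by (auto intro!: derivative_eq_intros has_derivative_line)
    moreover have "?\<gamma> d \<ge> \<mu> * t * B d d"
    proof (cases "t = 0")
      case False
      \<comment> \<open>Monotonicity is applied to the increment \<open>t d\<close>, so the wanted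
        bound appears multiplied by \<open>t\<close>, which is then cancelled.\<close>
      have "(y + t *\<^sub>R d) - y = t *\<^sub>R d" by simp
      from strongly_monotone[of "y + t *\<^sub>R d" y, unfolded this B_scale]
      have "t * (\<mu> * t * B d d) \<le> t * ?\<gamma> d"
        by (simp add: blinfun.scaleR_right power2_eq_square ac_simps)
      with False \<open>0 \<le> t\<close> show ?thesis by simp
    qed simp
    ultimately show "\<exists>D. (\<phi> has_real_derivative D) (at t) \<and> D \<ge> 0"
      by (auto simp: blinfun.diff_left)
  qed simp
  then show ?thesis by (simp add: \<phi>_def d_def)
qed

text \<open>In \<open>half\<close>, \<open>f\<close> is estimated at a gradient step of length
  \<open>1 / L\<close> from \<open>z\<close> for \<open>f - grad y\<close>: from above by descent at
  \<open>z\<close>, from below by convexity at \<open>y\<close>. Adding the two versions with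
  \<open>y\<close> and \<open>z\<close> swapped eliminates the function values.\<close>

lemma cocoercive: "(grad z - grad y) (inv B (grad z - grad y)) \<le> L * (grad z - grad y) (z - y)"
proof -
  have half: "f y + grad y (z - y) + N / (2 * L) \<le> f z"
    if N: "N = (grad z - grad y) (inv B (grad z - grad y))" for y z N
  proof -
    define r where "r = inv B (grad z - grad y)"
    have N': "N = grad z r - grad y r" by (simp add: N r_def blinfun.diff_left)
    have "B r r = N" by (simp add: N r_def spd_inv[OF B])
    then have "f (z - (1 / L) *\<^sub>R r) \<le> f z - (1 / L) * grad z r + L / 2 * ((1 / L)\<^sup>2 * N)"
      using descent_along[of z "1 / L" r] by simp
    moreover have "f y + grad y (z - y) - (1 / L) * grad y r \<le> f (z - (1 / L) *\<^sub>R r)"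
    proof -
      let ?w = "z - (1 / L) *\<^sub>R r"
      have "0 \<le> \<mu> / 2 * B (?w - y) (?w - y)" using pos spd_nonneg[OF B] by simp
      moreover have "grad y (?w - y) = grad y (z - y) - (1 / L) * grad y r"
        by (simp add: blinfun.diff_right blinfun.scaleR_right)
      ultimately show ?thesis using strong_convexity[of y ?w] by linarith
    qed
    moreover have "L / 2 * ((1 / L)\<^sup>2 * N) = N / (2 * L)"
      using pos by (simp add: field_simps power2_eq_square)
    moreover have "(1 / L) * grad z r - (1 / L) * grad y r = 2 * (N / (2 * L))"
      using pos by (simp add: N' field_simps)
    ultimately show ?thesis by linarith
  qed
  let ?N = "(grad z - grad y) (inv B (grad z - grad y))"
  have N: "(grad y - grad z) (inv B (grad y - grad z)) = ?N"
    using linear_neg[OF linear_inv_spd[OF B], of "grad z - grad y"]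
    by (metis (no_types, lifting) blinfun.minus_left blinfun.minus_right minus_diff_eq minus_minus)
  have "grad y (z - y) + grad z (y - z) + 2 * (?N / (2 * L)) \<le> 0"
    using half[OF refl, of y z] half[OF refl, of z y] unfolding N by linarith
  moreover have "(grad z - grad y) (z - y) = - (grad y (z - y) + grad z (y - z))"
    by (simp add: blinfun.diff_left blinfun.diff_right)
  moreover have "2 * (?N / (2 * L)) = ?N / L" by simp
  ultimately have "?N / L \<le> (grad z - grad y) (z - y)" by linarith
  with pos show ?thesis by (simp add: field_simps)
qed

text \<open>Completing the square minimizes the strong-convexity lower bound over all increments
  \<open>d\<close>.\<close>

lemma gradient_dominated: "f y - f z \<le> grad y (inv B (grad y)) / (2 * \<mu>)"
proof -
  define d where "d = z - y"
  define r where "r = inv B (grad y)"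
  have r: "B r = grad y" by (simp add: r_def spd_inv[OF B])
  have "0 \<le> B (r + \<mu> *\<^sub>R d) (r + \<mu> *\<^sub>R d)" by (rule spd_nonneg[OF B])
  also have "\<dots> = grad y r + 2 * \<mu> * (grad y d + \<mu> / 2 * B d d)"
    using spd_sym[OF B, of d r]
    by (simp add: spd_linear_simps[OF B] r blinfun.add_left blinfun.add_right blinfun.scaleR_left
        blinfun.scaleR_right algebra_simps)
  finally have "- (grad y d + \<mu> / 2 * B d d) \<le> grad y r / (2 * \<mu>)"
    using pos by (simp add: field_simps)
  with strong_convexity[of y z] show ?thesis by (simp add: d_def r_def)
qed

lemma gradient_step: "f (y - (1 / L) *\<^sub>R inv B (grad y)) \<le> f y - grad y (inv B (grad y)) / (2 * L)"
proof -
  define r where "r = inv B (grad y)"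
  have "B r r = grad y r" by (simp add: r_def spd_inv[OF B])
  then have "f (y - (1 / L) *\<^sub>R r) \<le> f y - (1 / L) * grad y r + L / 2 * ((1 / L)\<^sup>2 * grad y r)"
    using descent_along[of y "1 / L" r] by simp
  also have "\<dots> = f y - grad y r / (2 * L)"
    using pos by (simp add: field_simps power2_eq_square)
  finally show ?thesis by (simp add: r_def)
qed

text \<open>Compactness of the unit sphere bounds \<open>B w w\<close> below by a multiple of the
  squared norm. Strong convexity at 0 then keeps \<open>f\<close> at or above \<open>f 0\<close>
  outside a ball, so a minimizer on the ball is global.\<close>

lemma has_minimizer: "\<exists>z. \<forall>y. f z \<le> f y"
proof -
  have "continuous_on UNIV B"
    using spd_linear[OF B] by (intro linear_continuous_on) (simp only: linear_conv_bounded_linear)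
  then have "continuous_on (sphere 0 1) (\<lambda>v. B v v)"
    using continuous_on_subset
    by (intro bounded_bilinear.continuous_on[OF bounded_bilinear_blinfun_apply] continuous_on_id) blast
  then obtain v where v: "v \<in> sphere 0 1" "\<forall>w\<in>sphere 0 1. B v v \<le> B w w"
    using continuous_attains_inf[of "sphere (0::'a) 1" "\<lambda>v. B v v"] by (simp only: compact_sphere) force
  define m where "m = B v v"
  have "v \<noteq> 0" using v(1) by auto
  then have "m > 0" unfolding m_def by (rule spd_pos[OF B])
  have coercive: "m * (norm w)\<^sup>2 \<le> B w w" for w
  proof (cases "w = 0")
    case False
    then have "m \<le> B ((1 / norm w) *\<^sub>R w) ((1 / norm w) *\<^sub>R w)" 
      unfolding m_def by (intro v(2)[rule_format]) simp
    with False show ?thesis by (simp only: B_scale) (simp add: field_simps)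
  qed simp
  \<comment> \<open>From this radius on, the quadratic term of the strong-convexity bound dominates
    the linear one.\<close>
  define R where "R = 2 * norm (grad 0) / (\<mu> * m)"
  have "continuous_on UNIV f"
    using has_derivative_continuous[OF differentiable] by (simp add: continuous_on_eq_continuous_within)
  then have "continuous_on (cball 0 R) f" by (rule continuous_on_subset) simp
  moreover have "R \<ge> 0" using pos \<open>m > 0\<close> by (simp add: R_def)
  ultimately obtain z where z: "\<And>y. norm y \<le> R \<Longrightarrow> f z \<le> f y"
    using continuous_attains_inf[of "cball 0 R" f] by (force simp: mem_cball_0)
  have "f z \<le> f y" for y
  proof (cases "norm y \<le> R")
    case False
    have "- (norm (grad 0) * norm y) \<le> grad 0 y"
      using norm_blinfun[of "grad 0" y] by (simp add: abs_le_iff)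
    moreover have "norm (grad 0) \<le> \<mu> / 2 * m * norm y"
      using False pos \<open>m > 0\<close> by (simp add: R_def field_simps)
    then have "norm (grad 0) * norm y \<le> \<mu> / 2 * m * norm y * norm y"
      by (rule mult_right_mono) simp
    moreover have "\<mu> / 2 * (m * (norm y)\<^sup>2) \<le> \<mu> / 2 * B y y"
      using coercive[of y] pos by (intro mult_left_mono) auto
    ultimately have "f 0 \<le> f y"
      using strong_convexity[of 0 y] by (simp add: power2_eq_square algebra_simps)
    with z[of 0] \<open>R \<ge> 0\<close> show ?thesis by simp
  qed (rule z)
  then show ?thesis by blast
qed

end

section \<open>Convergence rate\<close>

lemma one_minus_inverse_le_ln: "1 - 1 / q \<le> ln q" if "q > 0" for q :: real
  using ln_le_minus_one[of "1 / q"] that by (simp add: ln_div)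

text \<open>Serves the unit step, whose curvature bound puts \<open>q\<close> in the denominator, so
  \<open>2 * ln q\<close> must be produced. Hence the basic inequality is used at
  \<open>2 * q\<close> and doubled, and \<open>ln 2 <= 1\<close> absorbs the surplus
  constant.\<close>

lemma one_minus_inverse_le_ln_mult:
  fixes q \<kappa> :: real
  assumes "q > 0" "\<kappa> > 0"
  shows "1 - 1 / q + ln (\<kappa> / q) \<le> ln (2 * \<kappa> * q)"
proof -
  have "1 - 1 / (2 * q) \<le> ln 2 + ln q"
    using one_minus_inverse_le_ln[of "2 * q"] assms by (simp add: ln_mult)
  then have "2 - 1 / q \<le> 2 * ln 2 + 2 * ln q" by (simp add: field_simps)
  moreover have "ln 2 \<le> (1::real)" using ln_le_minus_one[of "2::real"] by simp
  ultimately have "1 - 1 / q \<le> ln 2 + 2 * ln q" by linarith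
  with assms show ?thesis by (simp add: ln_mult ln_div)
qed

context smooth_strongly_convex
begin

lemma spd_scaled: "spd (\<lambda>u. L *\<^sub>R B u)" (is "spd ?X")
proof -
  have "linear ?X" using spd_linear[OF B] linear_compose_scale_right by blast
  moreover have "?X u v = ?X v u" for u v by (simp add: blinfun.scaleR_left spd_sym[OF B, of u v])
  moreover have "?X u u > 0" if "u \<noteq> 0" for u
    using pos spd_pos[OF B that] by (simp add: blinfun.scaleR_left)
  ultimately show ?thesis by (simp add: spd_def)
qed

lemma inv_scaled: "inv (\<lambda>u. L *\<^sub>R B u) s = (1 / L) *\<^sub>R inv B s"
  using pos by (intro spd_inv_eqI[OF spd_scaled]) (simp add: spd_linear_simps[OF B] spd_inv[OF B])

text \<open>
  The potential grows by at most \<open>1 - 1/q + ln (h\<^sup>2 \<langle>\<nabla>f y, d\<rangle> / \<langle>\<gamma>, \<delta>\<rangle>)\<close>. The curvature \<open>\<langle>\<gamma>, \<delta>\<rangle>\<close>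
  is bounded below by strong monotonicity if the unit step is accepted, and through the failure
  of sufficient decrease at \<open>2h\<close> otherwise.
\<close>
lemma potential_step:
  fixes G :: "'a \<Rightarrow> 'a dual" and y d :: 'a and h \<eta> q :: real
  assumes G: "spd G" and d: "G d = grad y" and nz: "grad y \<noteq> 0"
    and h: "h > 0" and \<eta>: "\<eta> \<le> 1 / 2"
    and rejected: "h = 1 \<or> \<not> sufficient_decrease f grad \<eta> y d (2 * h)"
    and curv: "(grad (y - h *\<^sub>R d) - grad y) (- h *\<^sub>R d) > 0"
    and q: "q = L * grad y d / grad y (inv B (grad y))"
  shows "psi (\<lambda>u. L *\<^sub>R B u) (inverse_update G (- h *\<^sub>R d) (grad (y - h *\<^sub>R d) - grad y))
    - psi (\<lambda>u. L *\<^sub>R B u) G \<le> ln (2 * (L / \<mu>) * h * q)"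
proof -
  let ?X = "\<lambda>u. L *\<^sub>R B u" and ?\<delta> = "- h *\<^sub>R d" and ?\<gamma> = "grad (y - h *\<^sub>R d) - grad y"
  define a where "a = grad y d"
  define b where "b = B d d"
  define N where "N = grad y (inv B (grad y))"
  define c where "c = ?\<gamma> ?\<delta>"
  have c: "c > 0" using curv by (simp add: c_def)
  have "d \<noteq> 0" using nz d by (auto simp: spd_linear_simps[OF G])
  then have a: "a > 0" and b: "b > 0" using spd_pos[OF G, of d] spd_pos[OF B, of d] d by (auto simp: a_def b_def)
  have N: "N > 0" unfolding N_def by (rule spd_inv_pos[OF B nz])
  have q_pos: "q > 0" and q_inv: "1 / q = N / (L * a)"
    using a N pos by (simp_all add: q flip: a_def N_def)
  have G\<delta>: "G ?\<delta> = (- h) *\<^sub>R grad y" by (simp only: spd_linear_simps[OF G] d)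
  have G\<delta>\<delta>: "G ?\<delta> ?\<delta> = h\<^sup>2 * a"
    by (simp only: G\<delta> blinfun.scaleR_left blinfun.scaleR_right) (simp add: a_def power2_eq_square)
  have "G ?\<delta> (inv ?X (G ?\<delta>)) = h\<^sup>2 * N / L"
    unfolding G\<delta> inv_scaled linear_cmul[OF linear_inv_spd[OF B]] blinfun.scaleR_left blinfun.scaleR_right
    by (simp add: N_def power2_eq_square)
  then have first: "G ?\<delta> (inv ?X (G ?\<delta>)) / G ?\<delta> ?\<delta> = 1 / q"
    unfolding q_inv G\<delta>\<delta> using a h pos by (simp add: field_simps)
  \<comment> \<open>The scaling \<open>X = L B\<close> is what makes co-coercivity bound this trace
    contribution by 1.\<close>
  have "?\<gamma> (inv B ?\<gamma>) \<le> L * c"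
    using cocoercive[of "y - h *\<^sub>R d" y] by (simp add: c_def)
  then have "(1 / L) * ?\<gamma> (inv B ?\<gamma>) / c \<le> 1" using c pos by (simp add: field_simps)
  then have second: "?\<gamma> (inv ?X ?\<gamma>) / ?\<gamma> ?\<delta> \<le> 1"
    by (simp only: inv_scaled c_def blinfun.scaleR_right[of ?\<gamma> "1 / L"] real_scaleR_def)
  have "det (endo_matrix (\<lambda>u. inv ?X (G u))) > 0"
    using det_pos_psi_nonneg[OF spd_scaled G] by blast
  from psi_inverse_update[of ?X G ?\<gamma> ?\<delta>, OF spd_scaled G curv this] first second
  have "psi ?X (inverse_update G ?\<delta> ?\<gamma>) - psi ?X G \<le> 1 - 1 / q - ln (c / (h\<^sup>2 * a))"
    unfolding G\<delta>\<delta> c_def by linarith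
  moreover have "- ln (c / (h\<^sup>2 * a)) = ln (h\<^sup>2 * a / c)"
    using a c h by (simp add: ln_div)
  ultimately have growth: "psi ?X (inverse_update G ?\<delta> ?\<gamma>) - psi ?X G \<le> 1 - 1 / q + ln (h\<^sup>2 * a / c)"
    by linarith
  have "\<mu> * (h\<^sup>2 * b) \<le> c"
    using strongly_monotone[of "y - h *\<^sub>R d" y] B_scale[of "- h" d] by (simp add: c_def b_def)
  have CS: "a\<^sup>2 \<le> N * b" unfolding a_def N_def b_def by (rule spd_dual_Cauchy_Schwarz[OF B])
  show ?thesis
  proof (cases "h = 1")
    case True
    \<comment> \<open>Strong monotonicity bounds \<open>c\<close> below by \<open>\<mu> * b\<close>,
      and Cauchy-Schwarz trades \<open>b\<close> for \<open>a\<^sup>2 / N\<close>, giving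
      \<open>\<kappa> / q\<close>.\<close>
    have "a / c \<le> a / (\<mu> * b)"
      using \<open>\<mu> * (h\<^sup>2 * b) \<le> c\<close> True a b c pos by (intro divide_left_mono) auto
    also have "\<dots> \<le> N / (\<mu> * a)"
      using CS a b pos by (simp add: field_simps power2_eq_square)
    also have "\<dots> = L / \<mu> / q"
      using pos a N by (simp add: q field_simps flip: a_def N_def)
    finally have "ln (h\<^sup>2 * a / c) \<le> ln (L / \<mu> / q)"
      using True a c pos q_pos by simp
    also have "1 - 1 / q + \<dots> \<le> ln (2 * (L / \<mu>) * q)"
      using pos q_pos by (intro one_minus_inverse_le_ln_mult) auto
    finally show ?thesis using growth True by simp
  next
    case False
    \<comment> \<open>Failure at \<open>2 * h\<close>, with \<open>\<eta> <= 1/2\<close>,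
      contradicts the descent inequality unless \<open>a <= 2 * L * h * b\<close>. So
      \<open>b\<close>, and with it the curvature \<open>c\<close>, cannot be small.\<close>
    with rejected have "f y - f (y - (2 * h) *\<^sub>R d) < \<eta> * (2 * h) * a"
      by (simp add: sufficient_decrease_def a_def)
    also have "\<dots> \<le> h * a" using \<eta> a h by simp
    finally have "2 * h * a - 2 * L * h\<^sup>2 * b \<le> h * a"
      using descent_along[of y "2 * h" d] by (simp add: a_def b_def power2_eq_square)
    then have "\<mu> * (h * a) \<le> \<mu> * (2 * L * h\<^sup>2 * b)" using pos by (intro mult_left_mono) (auto simp: ac_simps)
    also have "\<dots> \<le> 2 * L * c"
      using \<open>\<mu> * (h\<^sup>2 * b) \<le> c\<close> pos by (simp add: field_simps)
    finally have "h\<^sup>2 * a / c \<le> 2 * (L / \<mu>) * h"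
      using pos c h by (simp add: field_simps power2_eq_square)
    then have "ln (h\<^sup>2 * a / c) \<le> ln (2 * (L / \<mu>) * h)" using a c h pos by simp
    moreover have "1 - 1 / q \<le> ln q" using q_pos by (rule one_minus_inverse_le_ln)
    moreover have "ln (2 * (L / \<mu>) * h * q) = ln (2 * (L / \<mu>) * h) + ln q"
      using pos h q_pos by (intro ln_mult_pos) auto
    ultimately show ?thesis using growth by linarith
  qed
qed

end

section \<open>From one-step factors to a geometric rate\<close>

lemma prod_le_mean_power:
  fixes u :: "'i \<Rightarrow> real"
  assumes "finite S" "S \<noteq> {}" and nonneg: "\<And>j. j \<in> S \<Longrightarrow> u j \<ge> 0"
  shows "prod u S \<le> (sum u S / card S) ^ card S"
proof -
  have card: "card S > 0" using assms by (simp add: card_gt_0_iff)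
  have P: "prod u S \<ge> 0" by (rule prod_nonneg) (rule nonneg)
  have "prod u S = (prod u S powr (1 / card S)) ^ card S"
    using card P by (cases "prod u S = 0") (auto simp: powr_power)
  also have "\<dots> \<le> (sum u S / card S) ^ card S"
    using arith_geom_mean[OF assms(1,2) nonneg] by (intro power_mono) (auto simp: sum_divide_distrib)
  finally show ?thesis .
qed

text \<open>AM-GM for the \<open>r j\<close> gives \<open>c <= m\<close> for their mean
  \<open>m\<close>; AM-GM for the factors \<open>1 - r j\<close> bounds their product by
  \<open>(1 - m) ^ k\<close>.\<close>

lemma geometric_mean_rate:
  fixes a r :: "nat \<Rightarrow> real" and c :: real
  assumes a: "\<And>j. a j > 0" and r: "\<And>j. r j > 0"
    and contract: "\<And>j. a (Suc j) \<le> (1 - r j) * a j"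
    and k: "k \<ge> 1" and c: "c \<ge> 0" "c ^ k \<le> (\<Prod>j<k. r j)"
  shows "a k \<le> (1 - c) ^ k * a 0"
proof -
  \<comment> \<open>The gap stays positive after the step, so no contraction factor can be
    negative.\<close>
  have r1: "1 - r j \<ge> 0" for j
    using contract[of j] a[of j] a[of "Suc j"] by (smt (verit) mult_nonpos_nonneg)
  have ne: "{..<k} \<noteq> {}" using k by (auto simp: lessThan_empty_iff)
  define m where "m = (\<Sum>j<k. r j) / k"
  have "m \<ge> 0" using r by (simp add: m_def sum_nonneg less_imp_le)
  have "(\<Prod>j<k. r j) \<le> m ^ k"
    using prod_le_mean_power[OF finite_lessThan ne, of r] r by (simp add: m_def less_imp_le)
  with c(2) have "c ^ k \<le> m ^ k" by linarith
  then have "c \<le> m" using k \<open>m \<ge> 0\<close> by (metis Suc_le_D One_nat_def power_le_imp_le_base)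
  have "a n \<le> (\<Prod>j<n. 1 - r j) * a 0" for n
  proof (induction n)
    case (Suc n)
    from contract[of n] mult_left_mono[OF Suc r1[of n]] show ?case by (simp add: ac_simps)
  qed simp
  moreover have "(\<Prod>j<k. 1 - r j) \<le> (1 - c) ^ k"
  proof -
    have mean: "(\<Sum>j<k. 1 - r j) / k = 1 - m" using k by (simp add: m_def sum_subtractf diff_divide_distrib)
    then have "0 \<le> 1 - m" using r1 by (metis divide_nonneg_nonneg of_nat_0_le_iff sum_nonneg)
    have "(\<Prod>j<k. 1 - r j) \<le> (1 - m) ^ k"
      using prod_le_mean_power[OF finite_lessThan ne, of "\<lambda>j. 1 - r j"] r1 mean by simp
    also have "\<dots> \<le> (1 - c) ^ k" using \<open>c \<le> m\<close> \<open>0 \<le> 1 - m\<close> by (intro power_mono) auto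
    finally show ?thesis .
  qed
  ultimately show ?thesis using a[of 0] by (meson mult_right_mono less_imp_le order_trans)
qed

theorem theorem4p12:
  fixes B :: "'a::euclidean_space \<Rightarrow> 'a dual"
    and f :: "'a \<Rightarrow> real"
    and grad :: "'a \<Rightarrow> 'a dual"
    and \<mu> L \<kappa> \<eta>\<^sub>1 f_star \<psi>\<^sub>0 :: real
    and x :: "nat \<Rightarrow> 'a"
    and H :: "nat \<Rightarrow> 'a dual \<Rightarrow> 'a"
    and h :: "nat \<Rightarrow> real"
    and i :: "nat \<Rightarrow> nat"
  assumes B: "spd B"
    and differentiable: "\<And>y. (f has_derivative blinfun_apply (grad y)) (at y)"
    and pos: "\<mu> > 0" "L > 0"
    and strongly_monotone:
      "\<And>y z. blinfun_apply (grad y - grad z) (y - z) \<ge> \<mu> * (norm_wrt B (y - z))\<^sup>2"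
    and Lipschitz_gradient:
      "\<And>y z. dual_norm_wrt B (grad y - grad z) \<le> L * norm_wrt B (y - z)"
    and f_star: "f_star = (LEAST v. v \<in> range f)"
    and \<kappa>: "\<kappa> = L / \<mu>"
    and \<eta>\<^sub>1: "0 < \<eta>\<^sub>1" "\<eta>\<^sub>1 \<le> 1 / 2"
    and run: "bfgs_run grad h x H"
    and curvature:
      "\<And>k. blinfun_apply (grad (x (Suc k)) - grad (x k)) (x (Suc k) - x k) > 0"
    and step: "\<And>k. h k = (1 / 2) ^ i k"
    and backtracking:
      "\<And>k. sufficient_decrease f grad \<eta>\<^sub>1 (x k) (H k (grad (x k))) ((1 / 2) ^ i k)"
      "\<And>k j. j < i k \<Longrightarrow>
        \<not> sufficient_decrease f grad \<eta>\<^sub>1 (x k) (H k (grad (x k))) ((1 / 2) ^ j)"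
    and \<psi>\<^sub>0: "\<psi>\<^sub>0 = psi (\<lambda>u. L *\<^sub>R B u) (inv (H 0))"
  shows "\<forall>k\<ge>1. f (x k) - f_star
    \<le> (1 - \<eta>\<^sub>1 * \<kappa> powi (- 2) * exp (- \<psi>\<^sub>0 / real k)) ^ k * (f (x 0) - f_star)"
proof (intro allI impI)
  fix k :: nat
  assume k: "k \<ge> 1"
  interpret smooth_strongly_convex B f grad \<mu> L
  proof
    show "(grad y - grad z) (y - z) \<ge> \<mu> * B (y - z) (y - z)" for y z
      using strongly_monotone[of y z] spd_nonneg[OF B] by (simp add: norm_wrt_def)
    show "(grad y - grad z) (inv B (grad y - grad z)) \<le> L\<^sup>2 * B (y - z) (y - z)" for y z
      using power_mono[OF Lipschitz_gradient[of y z], of 2] spd_nonneg[OF B] spd_inv_nonneg[OF B]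
      by (simp add: dual_norm_wrt_def norm_wrt_def power_mult_distrib)
  qed (rule B differentiable pos)+
  have H0: "spd_dual (H 0)" and h: "\<And>j. h j > 0"
    and x: "\<And>j. x (Suc j) = x j - h j *\<^sub>R H j (grad (x j))"
    and H_Suc: "\<And>j. H (Suc j) = bfgs_update (H j) (x (Suc j) - x j) (grad (x (Suc j)) - grad (x j))"
    using run by (auto simp: bfgs_run_def)
  let ?X = "\<lambda>u. L *\<^sub>R B u"
  define G where "G j = inv (H j)" for j
  define \<delta> where "\<delta> j = x (Suc j) - x j" for j
  define \<gamma> where "\<gamma> j = grad (x (Suc j)) - grad (x j)" for j
  have curv: "\<gamma> j (\<delta> j) > 0" for j using curvature by (simp add: \<gamma>_def \<delta>_def)
  \<comment> \<open>The recursion for \<open>G\<close> and its positive definiteness depend on each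
    other, so both are first stated conditionally and then released by the induction
    \<open>inv_G\<close>.\<close>
  have update: "spd (inverse_update (G j) (\<delta> j) (\<gamma> j)) \<and>
      inv (inverse_update (G j) (\<delta> j) (\<gamma> j)) = H (Suc j)"
    if "spd (G j) \<and> inv (G j) = H j" for j
    using that curv[of j] spd_inverse_update[of "G j" "\<gamma> j" "\<delta> j"]
      bfgs_update_eq_inv[of "G j" "\<gamma> j" "\<delta> j"]
    by (simp add: H_Suc \<gamma>_def \<delta>_def)
  have G_Suc': "G (Suc j) = inverse_update (G j) (\<delta> j) (\<gamma> j)"
    if "spd (G j) \<and> inv (G j) = H j" for j
    using update[OF that] by (metis G_def inv_inv_eq spd_bij)
  have inv_G: "spd (G j) \<and> inv (G j) = H j" for j
  proof (induction j)
    case 0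
    then show ?case using spd_dual_inverse[OF H0] by (simp add: G_def)
  next
    case (Suc j)
    with update G_Suc' show ?case by simp
  qed
  note G_Suc = G_Suc'[OF inv_G]
  define d where "d j = H j (grad (x j))" for j
  have Gd: "G j (d j) = grad (x j)" for j
    using inv_G[of j] spd_inv(1)[of "G j"] by (metis d_def)
  have x_Suc: "x (Suc j) = x j - h j *\<^sub>R d j" for j by (simp add: x d_def)
  have \<delta>: "\<delta> j = - h j *\<^sub>R d j" for j by (simp add: \<delta>_def x_Suc)
  \<comment> \<open>A zero gradient would give a zero displacement, against positive
    curvature.\<close>
  have grad_nz: "grad (x j) \<noteq> 0" for j
  proof
    assume "grad (x j) = 0"
    moreover have "linear (H j)" using inv_G[of j] linear_inv_spd[of "G j"] by metis
    ultimately have "\<delta> j = 0" by (simp add: \<delta> d_def linear_0)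
    with curv[of j] show False by simp
  qed
  define N where "N j = grad (x j) (inv B (grad (x j)))" for j
  define s where "s j = grad (x j) (d j)" for j
  have N: "N j > 0" for j unfolding N_def by (rule spd_inv_pos[OF B grad_nz])
  have "d j \<noteq> 0" for j using curv[of j] by (auto simp: \<delta>)
  then have s: "s j > 0" for j
    using spd_pos[of "G j" "d j"] inv_G[of j] by (simp add: Gd s_def)
  define q where "q j = L * s j / N j" for j
  have q: "q j > 0" for j using N s pos by (simp add: q_def)
  have \<kappa>_pos: "\<kappa> > 0" using pos by (simp add: \<kappa>)
  \<comment> \<open>This normalization serves two ends:
    \<open>r j * (\<kappa>\<^sup>2 / \<eta>\<^sub>1)\<close> is the factor in the potential bound,
    and \<open>r j * N j / (2 * \<mu>)\<close> is the guaranteed decrease.\<close>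
  define r where "r j = 2 * \<eta>\<^sub>1 / \<kappa> * h j * q j" for j
  have r: "r j > 0" for j using \<eta>\<^sub>1 \<kappa>_pos h q by (simp add: r_def)

  have growth: "psi ?X (G (Suc j)) - psi ?X (G j) \<le> ln (r j * (\<kappa>\<^sup>2 / \<eta>\<^sub>1))" for j
  proof -
    \<comment> \<open>For \<open>i j = 0\<close> the unit step was accepted; otherwise
      \<open>2 * h j\<close> is the last rejected trial, of exponent \<open>i j - 1\<close>.\<close>
    have "h j = 1 \<or> \<not> sufficient_decrease f grad \<eta>\<^sub>1 (x j) (d j) (2 * h j)"
    proof (cases "i j")
      case (Suc n)
      then have "2 * h j = (1 / 2) ^ n" by (simp add: step)
      with backtracking(2)[of n j] Suc show ?thesis by (simp add: d_def)
    qed (simp add: step)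
    then have "psi ?X (G (Suc j)) - psi ?X (G j) \<le> ln (2 * (L / \<mu>) * h j * q j)"
      using potential_step[of "G j" "d j" "x j" "h j" \<eta>\<^sub>1 "q j"] inv_G Gd grad_nz h \<eta>\<^sub>1 curv
      by (simp add: G_Suc \<gamma>_def \<delta> x_Suc q_def s_def N_def)
    also have "2 * (L / \<mu>) * h j * q j = r j * (\<kappa>\<^sup>2 / \<eta>\<^sub>1)"
      using \<eta>\<^sub>1 \<kappa>_pos by (simp add: r_def power2_eq_square flip: \<kappa>)
    finally show ?thesis .
  qed

  \<comment> \<open>Existence of a minimizer makes the \<open>LEAST\<close> value an attained
    minimum.\<close>
  obtain z where z: "\<And>y. f z \<le> f y" using has_minimizer by blast
  have f_star: "f_star = f z"
    unfolding f_star by (rule Least_equality) (auto intro: z)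
  define a where "a j = f (x j) - f_star" for j
  \<comment> \<open>A gradient step from \<open>x j\<close> lowers \<open>f\<close> strictly, since
    the gradient is nonzero, so \<open>x j\<close> is not optimal.\<close>
  have a: "a j > 0" for j
  proof -
    have "N j / (2 * L) > 0" using N pos by simp
    with gradient_step[of "x j"] z[of "x j - (1 / L) *\<^sub>R inv B (grad (x j))"]
    show ?thesis unfolding a_def f_star N_def by linarith
  qed
  have contract: "a (Suc j) \<le> (1 - r j) * a j" for j
  proof -
    have "r j * a j \<le> r j * (N j / (2 * \<mu>))"
      using gradient_dominated[of "x j" z] r[of j] by (intro mult_left_mono) (auto simp: a_def f_star N_def)
    also have "\<dots> = \<eta>\<^sub>1 * h j * s j"
      using N[of j] pos by (simp add: r_def q_def \<kappa> field_simps)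
    also have "\<dots> \<le> f (x j) - f (x (Suc j))"
      using backtracking(1)[of j] step[of j] by (simp add: sufficient_decrease_def s_def d_def x)
    finally show ?thesis by (simp add: a_def algebra_simps)
  qed

  \<comment> \<open>Nonnegativity of the final potential leaves only the initial one, and the growth
    bounds telescope.\<close>
  have "- \<psi>\<^sub>0 \<le> psi ?X (G k) - psi ?X (G 0)"
    using det_pos_psi_nonneg[OF spd_scaled, of "G k"] inv_G[of k] by (simp add: \<psi>\<^sub>0 G_def)
  also have "\<dots> \<le> (\<Sum>j<k. ln (r j * (\<kappa>\<^sup>2 / \<eta>\<^sub>1)))"
    unfolding sum_lessThan_telescope[of "\<lambda>j. psi ?X (G j)", symmetric] by (rule sum_mono) (rule growth)
  finally have "exp (- \<psi>\<^sub>0) \<le> exp (\<Sum>j<k. ln (r j * (\<kappa>\<^sup>2 / \<eta>\<^sub>1)))" by simp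
  also have "\<dots> = (\<Prod>j<k. r j * (\<kappa>\<^sup>2 / \<eta>\<^sub>1))"
    using r \<kappa>_pos \<eta>\<^sub>1 by (simp add: exp_sum)
  also have "\<dots> = (\<Prod>j<k. r j) * (\<kappa>\<^sup>2 / \<eta>\<^sub>1) ^ k"
    by (simp only: prod.distrib prod_constant card_lessThan)
  finally have "exp (- \<psi>\<^sub>0) * (\<eta>\<^sub>1 / \<kappa>\<^sup>2) ^ k \<le> (\<Prod>j<k. r j)"
    using \<kappa>_pos \<eta>\<^sub>1 by (simp add: field_simps)
  \<comment> \<open>The rate constant is exactly the \<open>k\<close>-th root of the lower bound on
    the product.\<close>
  moreover have "(\<eta>\<^sub>1 * \<kappa> powi (- 2) * exp (- \<psi>\<^sub>0 / real k)) ^ k = exp (- \<psi>\<^sub>0) * (\<eta>\<^sub>1 / \<kappa>\<^sup>2) ^ k"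
  proof -
    have "exp (- \<psi>\<^sub>0 / real k) ^ k = exp (- \<psi>\<^sub>0)"
      using k by (simp flip: exp_of_nat_mult)
    moreover have "\<eta>\<^sub>1 * \<kappa> powi (- 2) = \<eta>\<^sub>1 / \<kappa>\<^sup>2"
      by (simp add: power_int_minus divide_inverse)
    ultimately show ?thesis by (metis power_mult_distrib mult.commute)
  qed
  ultimately have "a k \<le> (1 - \<eta>\<^sub>1 * \<kappa> powi (- 2) * exp (- \<psi>\<^sub>0 / real k)) ^ k * a 0"
    using \<eta>\<^sub>1 \<kappa>_pos by (intro geometric_mean_rate[where r = r] a r contract k) auto
  then show "f (x k) - f_star
      \<le> (1 - \<eta>\<^sub>1 * \<kappa> powi (- 2) * exp (- \<psi>\<^sub>0 / real k)) ^ k * (f (x 0) - f_star)"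
    by (simp add: a_def)
qed

end
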